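(* Let $P$ and $Q$ be two distributions in $\mathscr{P}_+$ on the same countably infinite alphabet $\mathscr{X}$. If $Q$ is in Domain 1 and $P$ is dominated by $Q$, then $P$ belongs to Domain 1.
   Context: $\mathscr{X}=\{\ell_k;k\ge 1\}$ is a countably infinite alphabet. $\mathscr{P}_+$ is the class of all probability distributions $P=\{p_k;k\ge 1\}$ on $\mathscr{X}$ with $p_k>0$ for every $k\ge 1$ (and $\sum_k p_k=1$). Tail index: for $P=\{p_k\}$ and $n\ge 1$, $t_n=t_n(P)=\sum_{k\ge 1}np_k(1-p_k)^n$. Domain 1: $P$ belongs to Domain 1 if $\limsup_{n\to\infty}t_n(P)=c_P$ for some (finite) constant $c_P>0$. Dominance: let $Q^*\in\mathscr{P}_+$ and $P=\{p_k\}\in\mathscr{P}_+$, and let $Q=\{q_k;k\ge1\}$ be a non-increasingly ordered version of $Q^*$. Then $Q^*$ is said to dominate $P$ (equivalently, $P$ is dominated by $Q^*$) if there is a finite positive integer $M$ such that $\#\{i\ge 1;\ p_i\in(q_{k+1},q_k]\}\le M$ for every $k\ge 1$, where $\#A$ denotes the cardinality of the set $A$. *)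

theory Defs
  imports "HOL-Probability.Probability"
begin

definition positive_dists :: "'a set \<Rightarrow> 'a pmf set"
  where "positive_dists X = {P. set_pmf P = X}"

text \<open>The terms are nonnegative and bounded by \<open>n * pmf P x\<close>, so the unordered sum exists and
  agrees with the series \<open>\<Sum>k\<ge>1. n p\<^sub>k (1 - p\<^sub>k)^n\<close> along any enumeration of the alphabet \<open>X\<close>.\<close>

definition tail_index :: "'a set \<Rightarrow> 'a pmf \<Rightarrow> nat \<Rightarrow> real"
  where "tail_index X P n = (\<Sum>\<^sub>\<infinity>x\<in>X. real n * pmf P x * (1 - pmf P x) ^ n)"

text \<open>The limit superior is taken in the extended reals, so that finiteness of the constant \<open>c\<close>
  is a genuine condition.\<close>

definition Domain1 :: "'a set \<Rightarrow> 'a pmf set"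
  where "Domain1 X = {P \<in> positive_dists X.
    \<exists>c::real. c > 0 \<and> limsup (\<lambda>n. ereal (tail_index X P n)) = ereal c}"

text \<open>Sequences are indexed from 1; the value \<open>q 0\<close> plays no role.\<close>

definition ordered_version :: "'a set \<Rightarrow> 'a pmf \<Rightarrow> (nat \<Rightarrow> real) \<Rightarrow> bool"
  where "ordered_version X Q q \<longleftrightarrow>
    antimono_on {1..} q \<and>
    (\<exists>\<sigma>. bij_betw \<sigma> {1..} X \<and> (\<forall>k\<ge>1. q k = pmf Q (\<sigma> k)))"

text \<open>The ordered version exists for every \<open>Q \<in> positive_dists X\<close> with \<open>X\<close> infinite and its values
  at \<open>k \<ge> 1\<close> are uniquely determined, so the existential choice of \<open>q\<close> is immaterial.
  Points are counted as letters \<open>x\<close> rather than as values \<open>pmf P x\<close>, i.e. with multiplicity.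
  Finiteness is required explicitly because \<open>card\<close> of an infinite set is 0.\<close>

definition dominates :: "'a set \<Rightarrow> 'a pmf \<Rightarrow> 'a pmf \<Rightarrow> bool"
  where "dominates X Q P \<longleftrightarrow>
    (\<exists>q. ordered_version X Q q \<and>
      (\<exists>M::nat. M > 0 \<and>
        (\<forall>k\<ge>1. finite {x \<in> X. pmf P x \<in> {q (k + 1)<..q k}} \<and>
                card {x \<in> X. pmf P x \<in> {q (k + 1)<..q k}} \<le> M)))"

end

theory Submission
  imports Defs
begin

text \<open>
  Write \<open>f\<^sub>n(p) = n p (1 - p)^n\<close>. It increases on \<open>[0, 1/(n+1)]\<close>, decreases on \<open>[1/(n+1), 1]\<close> and
  is at most \<open>1\<close>. Hence \<open>f\<^sub>n(p) \<le> f\<^sub>n(q\<^sub>k) + f\<^sub>n(q\<^sub>k\<^sub>+\<^sub>1)\<close> for \<open>p \<in> (q\<^sub>k\<^sub>+\<^sub>1, q\<^sub>k]\<close>, unless \<open>1/(n+1)\<close>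
  lies strictly inside this interval, which happens for at most one \<open>k\<close>. As every interval contains
  at most \<open>M\<close> of the \<open>p\<^sub>i\<close> and at most \<open>1/q\<^sub>1\<close> of them exceed \<open>q\<^sub>1\<close>, this gives
  \<open>t\<^sub>n(P) \<le> 2 M t\<^sub>n(Q) + M + 1/q\<^sub>1\<close>. Conversely, \<open>p\<^sub>i \<rightarrow> 0\<close>, and the choice
  \<open>n = \<lfloor>1/(2 p\<^sub>i)\<rfloor>\<close> shows that \<open>t\<^sub>n(P) \<ge> 1/8\<close> infinitely often.
\<close>

section \<open>Shape of a single summand as a function of the probability\<close>

definition tail_term :: "nat \<Rightarrow> real \<Rightarrow> real"
  where "tail_term n p = real n * p * (1 - p) ^ n"

lemma tail_index_eq: "tail_index X P n = (\<Sum>\<^sub>\<infinity>x\<in>X. tail_term n (pmf P x))"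
  by (simp add: tail_index_def tail_term_def)

lemma tail_term_nonneg: "0 \<le> p \<Longrightarrow> p \<le> 1 \<Longrightarrow> 0 \<le> tail_term n p"
  by (simp add: tail_term_def)

text \<open>By Bernoulli, \<open>1 + n p\<close> is at most \<open>(1 + p) ^ n\<close>, and the
  factors \<open>1 + p\<close> and \<open>1 - p\<close> multiply to
  \<open>1 - p\<^sup>2\<close>.\<close>

lemma tail_term_le_1:
  assumes "0 \<le> p" "p \<le> 1"
  shows "tail_term n p \<le> 1"
proof -
  have "tail_term n p \<le> (1 + real n * p) * (1 - p) ^ n"
    using assms by (auto simp: tail_term_def intro!: mult_right_mono)
  also have "\<dots> \<le> (1 + p) ^ n * (1 - p) ^ n"
    using assms Bernoulli_inequality[of p n] by (intro mult_right_mono) auto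
  also have "\<dots> = (1 - p\<^sup>2) ^ n"
    by (simp add: power_mult_distrib[symmetric] algebra_simps power2_eq_square)
  also have "\<dots> \<le> 1"
    using assms by (intro power_le_one) (auto simp: power_le_one)
  finally show ?thesis .
qed

text \<open>Derivative-free: Bernoulli bounds \<open>((1 - b) / (1 - a)) ^ n\<close> from below, and
  what remains is \<open>(b - a) * (1 - a - n b) \<ge> 0\<close>, which holds as
  \<open>(n + 1) b \<le> 1\<close>.\<close>

lemma tail_term_mono:
  assumes "0 \<le> a" "a \<le> b" "b \<le> 1 / (real n + 1)"
  shows "tail_term n a \<le> tail_term n b"
proof (cases "a = b \<or> n = 0")
  case True
  then show ?thesis by (auto simp: tail_term_def)
next
  case False
  then have n: "n \<ge> 1" and ab: "a < b" using assms by auto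
  have nb: "real n * b + b \<le> 1"
    using assms(3) by (simp add: field_simps)
  have "real n * b > 0" using n ab assms(1) by simp
  then have b1: "b < 1" using nb by linarith
  have "1 + real n * (- ((b - a) / (1 - a))) \<le> (1 + (- ((b - a) / (1 - a)))) ^ n"
    using ab b1 by (intro Bernoulli_inequality) (simp add: field_simps)
  also have "1 + (- ((b - a) / (1 - a))) = (1 - b) / (1 - a)"
    using ab b1 by (simp add: field_simps)
  finally have bern: "1 - real n * ((b - a) / (1 - a)) \<le> ((1 - b) / (1 - a)) ^ n"
    by simp
  have "0 \<le> (b - a) * (1 - a - real n * b)"
    using ab nb by (intro mult_nonneg_nonneg) auto
  then have "a \<le> b * (1 - real n * ((b - a) / (1 - a)))"
    using ab b1 by (simp add: field_simps)
  also have "\<dots> \<le> b * ((1 - b) / (1 - a)) ^ n"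
    using bern ab assms(1) by (intro mult_left_mono) auto
  finally have "a * (1 - a) ^ n \<le> b * ((1 - b) / (1 - a)) ^ n * (1 - a) ^ n"
    using ab b1 by (intro mult_right_mono) auto
  also have "\<dots> = b * (1 - b) ^ n"
    using ab b1 by (simp add: power_divide)
  finally show ?thesis
    by (simp add: tail_term_def mult.assoc mult_left_mono)
qed

text \<open>The same argument for the inverse ratio; it now reduces to
  \<open>(b - a) * (n a + b - 1) \<ge> 0\<close>. The ratio divides by \<open>1 - b\<close>, so
  \<open>b = 1\<close> is treated apart.\<close>

lemma tail_term_antimono:
  assumes "1 / (real n + 1) \<le> a" "a \<le> b" "b \<le> 1"
  shows "tail_term n b \<le> tail_term n a"
proof (cases "b = 1")
  case True
  have "0 \<le> 1 / (real n + 1)" by simp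
  then have "0 \<le> a" "a \<le> 1" using assms by linarith+
  then show ?thesis
    using True tail_term_nonneg[of a n] by (simp add: tail_term_def power_0_left)
next
  case False
  then have b1: "b < 1" using assms by simp
  have "0 < 1 / (real n + 1)" by simp
  then have a0: "0 < a" using assms(1) by linarith
  have na: "1 \<le> real n * a + a"
    using assms(1) by (simp add: field_simps)
  have "1 + real n * ((b - a) / (1 - b)) \<le> (1 + (b - a) / (1 - b)) ^ n"
    using b1 assms by (intro Bernoulli_inequality) (simp add: field_simps)
  also have "1 + (b - a) / (1 - b) = (1 - a) / (1 - b)"
    using b1 by (simp add: field_simps)
  finally have bern: "1 + real n * ((b - a) / (1 - b)) \<le> ((1 - a) / (1 - b)) ^ n" .
  have "0 \<le> (b - a) * (real n * a + b - 1)"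
    using assms na by (intro mult_nonneg_nonneg) auto
  then have "b \<le> a * (1 + real n * ((b - a) / (1 - b)))"
    using b1 by (simp add: field_simps)
  also have "\<dots> \<le> a * ((1 - a) / (1 - b)) ^ n"
    using bern a0 by (intro mult_left_mono) auto
  finally have "b * (1 - b) ^ n \<le> a * ((1 - a) / (1 - b)) ^ n * (1 - b) ^ n"
    using b1 by (intro mult_right_mono) auto
  also have "\<dots> = a * (1 - a) ^ n"
    using b1 by (simp add: power_divide)
  finally show ?thesis
    by (simp add: tail_term_def mult.assoc mult_left_mono)
qed

text \<open>Left of the peak \<open>b\<close> gives the bound, right of it \<open>a\<close>; the sum
  serves both cases.\<close>

lemma tail_term_le_endpoints:
  assumes "0 \<le> a" "a < p" "p \<le> b" "b \<le> 1"
  shows "tail_term n p \<le> tail_term n a + tail_term n b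
           + (if a < 1 / (real n + 1) \<and> 1 / (real n + 1) < b then 1 else 0)"
proof -
  have nn: "0 \<le> tail_term n a" "0 \<le> tail_term n b"
    using assms by (auto intro!: tail_term_nonneg)
  consider "b \<le> 1 / (real n + 1)" | "1 / (real n + 1) \<le> a"
    | "a < 1 / (real n + 1)" "1 / (real n + 1) < b"
    by linarith
  then show ?thesis
  proof cases
    case 1
    then show ?thesis using tail_term_mono[of p b n] assms nn by auto
  next
    case 2
    then show ?thesis using tail_term_antimono[of n a p] assms nn by auto
  next
    case 3
    then show ?thesis using tail_term_le_1[of p n] assms nn by auto
  qed
qed

text \<open>Bernoulli gives \<open>(1 - p) ^ n \<ge> 1 - n p \<ge> 1/2\<close>, and the other factor
  is at least \<open>1/4\<close>.\<close>

lemma tail_term_ge: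
  assumes "real n * p \<le> 1 / 2" "1 / 4 \<le> real n * p" "0 \<le> p" "p \<le> 1"
  shows "1 / 8 \<le> tail_term n p"
proof -
  have "1 - real n * p \<le> (1 - p) ^ n"
    using Bernoulli_inequality[of "-p" n] assms by simp
  then have "1 / 2 \<le> (1 - p) ^ n" using assms by linarith
  then have "1 / 4 * (1 / 2) \<le> real n * p * (1 - p) ^ n"
    using assms by (intro mult_mono) auto
  then show ?thesis by (simp add: tail_term_def)
qed

section \<open>Heavy letters and summability\<close>

lemma sum_pmf_le_1: "finite F \<Longrightarrow> (\<Sum>x\<in>F. pmf P x) \<le> 1"
  by (metis measure_measure_pmf_finite measure_pmf.prob_le_1)

lemma card_pmf_ge_le:
  assumes "finite F" "e > 0" "\<And>x. x \<in> F \<Longrightarrow> e \<le> pmf P x"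
  shows "real (card F) \<le> 1 / e"
proof -
  have "real (card F) * e \<le> (\<Sum>x\<in>F. pmf P x)"
    using assms(3) sum_bounded_below[of F e "pmf P"] by simp
  with sum_pmf_le_1[OF assms(1), of P] have "real (card F) * e \<le> 1" by linarith
  then show ?thesis using assms(2) by (simp add: field_simps)
qed

lemma finite_pmf_ge:
  assumes "e > 0"
  shows "finite {x. e \<le> pmf P x}"
proof (rule ccontr)
  assume "infinite {x. e \<le> pmf P x}"
  then obtain F where F: "F \<subseteq> {x. e \<le> pmf P x}" "finite F" "card F = nat \<lceil>1 / e\<rceil> + 1"
    using infinite_arbitrarily_large by blast
  then have "real (card F) \<le> 1 / e"
    using assms by (intro card_pmf_ge_le[of F e P]) auto
  with F(3) show False by linarith
qed

text \<open>Each term is at most \<open>n\<close> times the mass of its letter, so finite sums stay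
  below \<open>n\<close>. This rules out the default value 0 of a divergent infinite sum.\<close>

lemma summable_tail_term: "(\<lambda>x. tail_term n (pmf P x)) summable_on X"
proof (rule nonneg_bdd_above_summable_on)
  show "0 \<le> tail_term n (pmf P x)" for x
    by (intro tail_term_nonneg) (auto simp: pmf_le_1)
  have "(\<Sum>x\<in>F. tail_term n (pmf P x)) \<le> real n" if "finite F" for F
  proof -
    have "(\<Sum>x\<in>F. tail_term n (pmf P x)) \<le> (\<Sum>x\<in>F. real n * pmf P x)"
      unfolding tail_term_def
      by (intro sum_mono mult_right_le_one_le) (auto simp: pmf_le_1 power_le_one)
    also have "\<dots> \<le> real n * 1"
      unfolding sum_distrib_left[symmetric]
      using sum_pmf_le_1[OF that] by (intro mult_left_mono) auto
    finally show ?thesis by simp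
  qed
  then show "bdd_above (sum (\<lambda>x. tail_term n (pmf P x)) ` {F. F \<subseteq> X \<and> finite F})"
    by (intro bdd_aboveI[of _ "real n"]) auto
qed

lemma sum_tail_term_le_tail_index:
  assumes "finite F" "F \<subseteq> X"
  shows "(\<Sum>x\<in>F. tail_term n (pmf P x)) \<le> tail_index X P n"
  unfolding tail_index_eq
  using assms
  by (intro finite_sum_le_infsum summable_tail_term)
     (auto intro!: tail_term_nonneg simp: pmf_le_1)

section \<open>Lower bound along infinitely many indices\<close>

lemma tail_index_frequently_ge:
  assumes "infinite X" "P \<in> positive_dists X"
  shows "\<exists>\<^sub>F n in sequentially. 1 / 8 \<le> tail_index X P n"
  unfolding frequently_sequentially
proof
  fix N :: nat
  \<comment> \<open>A mass \<open>p < e\<close> satisfies both \<open>p < 1/4\<close>, which keeps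
    the rounding error small, and \<open>N p < 1/4\<close>, which forces the index found below to be
    at least \<open>N\<close>.\<close>
  define e where "e = 1 / (4 * (real N + 1))"
  have e: "e > 0" by (simp add: e_def)
  have "\<not> X \<subseteq> {x. e \<le> pmf P x}"
    using finite_pmf_ge[OF e] assms(1) finite_subset by blast
  then obtain x where x: "x \<in> X" "\<not> e \<le> pmf P x" by auto
  define p where "p = pmf P x"
  have p0: "0 < p"
    using x(1) assms(2) by (auto simp: positive_dists_def p_def pmf_positive)
  have p: "p < 1 / (4 * (real N + 1))" using x(2) unfolding p_def e_def not_le .
  have pN: "4 * (real N * p) + 4 * p < 1"
    using p by (simp add: field_simps)
  have Np: "0 \<le> real N * p" using p0 by simp
  \<comment> \<open>Rounding down puts \<open>n p\<close> in \<open>(1/2 - p, 1/2]\<close>, hence in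
    the window \<open>[1/4, 1/2]\<close>.\<close>
  define n where "n = nat \<lfloor>1 / (2 * p)\<rfloor>"
  have "0 \<le> 1 / (2 * p)" using p0 by simp
  then have n: "real n \<le> 1 / (2 * p)" "1 / (2 * p) < real n + 1"
    unfolding n_def by linarith+
  have up: "real n * p \<le> 1 / 2" using n(1) p0 by (simp add: field_simps)
  have "1 / 2 < real n * p + p" using n(2) p0 by (simp add: field_simps)
  then have lo: "1 / 4 \<le> real n * p" using pN Np by linarith
  have "real N * p < real n * p" using pN lo p0 by linarith
  then have "N \<le> n" using p0 by simp
  moreover have "1 / 8 \<le> tail_term n p"
    using up lo p0 by (intro tail_term_ge) (auto simp: p_def pmf_le_1)
  moreover have "tail_term n p \<le> tail_index X P n"
    using sum_tail_term_le_tail_index[of "{x}" X n P] x(1) by (simp add: p_def)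
  ultimately show "\<exists>n\<ge>N. 1 / 8 \<le> tail_index X P n" by (intro exI[of _ n]) auto
qed

section \<open>The bins cut out by an ordered version\<close>

lemma ordered_versionE:
  assumes "ordered_version X Q q"
  obtains \<sigma> where "bij_betw \<sigma> {1..} X" "\<And>k. k \<ge> 1 \<Longrightarrow> q k = pmf Q (\<sigma> k)"
    "\<And>i j. 1 \<le> i \<Longrightarrow> i \<le> j \<Longrightarrow> q j \<le> q i"
  using assms by (auto simp: ordered_version_def monotone_on_def)

text \<open>Injectivity of \<open>\<sigma>\<close> turns distinct indices into distinct letters, so
  tied values of \<open>q\<close> are counted correctly.\<close>

lemma sum_ordered_version_le_tail_index:
  assumes "ordered_version X Q q" "finite K" "K \<subseteq> {1..}"
  shows "(\<Sum>k\<in>K. tail_term n (q k)) \<le> tail_index X Q n"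
proof -
  obtain \<sigma> where \<sigma>: "bij_betw \<sigma> {1..} X" "\<And>k. k \<ge> 1 \<Longrightarrow> q k = pmf Q (\<sigma> k)"
    using assms(1) by (elim ordered_versionE) blast
  have "inj_on \<sigma> K"
    using \<sigma>(1) assms(3) by (auto simp: bij_betw_def intro: inj_on_subset)
  then have "(\<Sum>x\<in>\<sigma> ` K. tail_term n (pmf Q x)) = (\<Sum>k\<in>K. tail_term n (q k))"
    using assms(3) \<sigma>(2) by (subst sum.reindex) (auto intro!: sum.cong simp: subset_iff)
  moreover have "\<sigma> ` K \<subseteq> X"
    using \<sigma>(1) assms(3) by (auto simp: bij_betw_def)
  ultimately show ?thesis
    using sum_tail_term_le_tail_index[of "\<sigma> ` K" X n Q] assms(2) by simp
qed

text \<open>Only finitely many letters have mass at least \<open>p\<close>, so \<open>q\<close>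
  eventually drops below \<open>p\<close>; the first drop locates the bin.\<close>

lemma ordered_version_bin:
  assumes "ordered_version X Q q" "0 < p" "p \<le> q 1"
  shows "\<exists>k\<ge>1. p \<in> {q (k + 1)<..q k}"
proof -
  obtain \<sigma> where \<sigma>: "bij_betw \<sigma> {1..} X" "\<And>k. k \<ge> 1 \<Longrightarrow> q k = pmf Q (\<sigma> k)"
    using assms(1) by (elim ordered_versionE) blast
  have "\<exists>k\<ge>1. q k < p"
  proof (rule ccontr)
    assume "\<not> ?thesis"
    then have "\<sigma> ` {1..} \<subseteq> {x. p \<le> pmf Q x}" using \<sigma>(2) by force
    then have "finite (\<sigma> ` {1..})"
      using finite_pmf_ge[OF assms(2)] finite_subset by blast
    then show False
      using \<sigma>(1) by (auto simp: bij_betw_def finite_image_iff infinite_Ici)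
  qed
  then obtain j where j: "j \<ge> 1" "q j < p" by blast
  \<comment> \<open>The search starts at 0, but \<open>p \<le> q 1\<close> excludes
    \<open>k = 0\<close>; minimality at \<open>k - 1\<close> then reads
    \<open>p \<le> q k\<close>.\<close>
  define k where "k = (LEAST k. q (k + 1) < p)"
  have ex: "q (j - 1 + 1) < p" using j by simp
  have k: "q (k + 1) < p" unfolding k_def by (rule LeastI[of "\<lambda>k. q (k + 1) < p", OF ex])
  have "k \<ge> 1" using k assms(3) by (cases k) auto
  moreover have "\<not> q (k - 1 + 1) < p"
  proof (rule not_less_Least[of _ "\<lambda>k. q (k + 1) < p"])
    show "k - 1 < (LEAST k. q (k + 1) < p)"
      using \<open>k \<ge> 1\<close> unfolding k_def by linarith
  qed
  ultimately show ?thesis using k by (intro exI[of _ k]) auto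
qed

text \<open>For \<open>i < j\<close>, monotonicity gives \<open>q j \<le> q (i + 1) < c\<close>,
  against \<open>c < q j\<close>. It is applied with \<open>c\<close> the peak of the
  summand.\<close>

lemma card_straddling_le_1:
  fixes q :: "nat \<Rightarrow> real"
  assumes "\<And>i j. 1 \<le> i \<Longrightarrow> i \<le> j \<Longrightarrow> q j \<le> q i" "finite K" "K \<subseteq> {1..}"
  shows "card {k \<in> K. q (k + 1) < c \<and> c < q k} \<le> 1"
proof -
  have "i = j" if "i \<ge> 1" "j \<ge> 1" "q (i + 1) < c" "c < q i" "q (j + 1) < c" "c < q j" for i j
  proof (rule ccontr)
    assume "i \<noteq> j"
    then consider "i + 1 \<le> j" | "j + 1 \<le> i" by linarith
    then show False
      using assms(1)[of "i + 1" j] assms(1)[of "j + 1" i] that by cases auto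
  qed
  then show ?thesis
    using assms(2,3) by (intro card_le_Suc0_iff_eq[THEN iffD2, folded One_nat_def] ballI)
      (auto simp: subset_iff)
qed

section \<open>Comparison of the two tail indices\<close>

lemma tail_index_dominated_le:
  assumes "P \<in> positive_dists X" "ordered_version X Q q" "q 1 > 0"
    and bins: "\<And>k. k \<ge> 1 \<Longrightarrow> finite {x \<in> X. pmf P x \<in> {q (k + 1)<..q k}} \<and>
                card {x \<in> X. pmf P x \<in> {q (k + 1)<..q k}} \<le> M"
  shows "tail_index X P n \<le> 2 * real M * tail_index X Q n + real M + 1 / q 1"
  unfolding tail_index_eq[of X P]
proof (rule infsum_le_finite_sums[OF summable_tail_term])
  fix F assume F: "finite F" "F \<subseteq> X"
  obtain \<sigma> where \<sigma>: "\<And>k. k \<ge> 1 \<Longrightarrow> q k = pmf Q (\<sigma> k)"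
    and mono: "\<And>i j. 1 \<le> i \<Longrightarrow> i \<le> j \<Longrightarrow> q j \<le> q i"
    using assms(2) by (elim ordered_versionE) blast
  have q01: "0 \<le> q k \<and> q k \<le> 1" if "k \<ge> 1" for k
    using \<sigma>[OF that] by (simp add: pmf_le_1)
  have ppos: "0 < pmf P x" if "x \<in> X" for x
    using that assms(1) by (auto simp: positive_dists_def pmf_positive)
  define c where "c = 1 / (real n + 1)"
  define straddle where "straddle k = (if q (k + 1) < c \<and> c < q k then 1 else 0 :: real)" for k
  define bound where
    "bound k = tail_term n (q (k + 1)) + tail_term n (q k) + straddle k" for k
  \<comment> \<open>Letters heavier than \<open>q 1\<close> lie in no bin and are estimated by their
    number alone.\<close>
  define G where "G = {x \<in> F. q 1 < pmf P x}"
  define H where "H = {x \<in> F. pmf P x \<le> q 1}"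
  have "\<forall>x\<in>H. \<exists>k\<ge>1. pmf P x \<in> {q (k + 1)<..q k}"
    using ordered_version_bin[OF assms(2)] ppos F(2) by (auto simp: H_def)
  then obtain \<kappa> where \<kappa>: "\<And>x. x \<in> H \<Longrightarrow> \<kappa> x \<ge> 1"
    "\<And>x. x \<in> H \<Longrightarrow> pmf P x \<in> {q (\<kappa> x + 1)<..q (\<kappa> x)}"
    by metis
  define K where "K = \<kappa> ` H"
  have fin: "finite G" "finite H" "finite K" and K1: "K \<subseteq> {1..}"
    using F(1) \<kappa>(1) by (auto simp: G_def H_def K_def)

  have "(\<Sum>x\<in>G. tail_term n (pmf P x)) \<le> real (card G) * 1"
    by (intro sum_bounded_above tail_term_le_1) (auto simp: pmf_le_1)
  also have "\<dots> \<le> 1 / q 1"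
    using card_pmf_ge_le[OF fin(1) assms(3), of P] by (auto simp: G_def)
  finally have sumG: "(\<Sum>x\<in>G. tail_term n (pmf P x)) \<le> 1 / q 1" .

  have bound_nonneg: "0 \<le> bound k" if "k \<ge> 1" for k
    using q01[OF that] q01[of "k + 1"]
    by (auto simp: bound_def straddle_def intro!: add_nonneg_nonneg tail_term_nonneg)
  \<comment> \<open>Domination enters here: the fibre of \<open>\<kappa>\<close> over
    \<open>k\<close> sits inside the \<open>k\<close>-th bin.\<close>
  have inner: "(\<Sum>x\<in>{x \<in> H. \<kappa> x = k}. tail_term n (pmf P x)) \<le> real M * bound k"
    if "k \<in> K" for k
  proof -
    have k: "k \<ge> 1" using that K1 by auto
    have "card {x \<in> H. \<kappa> x = k} \<le> card {x \<in> X. pmf P x \<in> {q (k + 1)<..q k}}"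
      using bins[OF k] \<kappa>(2) F(2) by (intro card_mono) (auto simp: H_def)
    also have "\<dots> \<le> M" using bins[OF k] by simp
    finally have cardM: "real (card {x \<in> H. \<kappa> x = k}) \<le> real M" by simp
    have "tail_term n (pmf P x) \<le> bound k" if "x \<in> H" "\<kappa> x = k" for x
      using tail_term_le_endpoints[of "q (k + 1)" "pmf P x" "q k" n] \<kappa>(2)[OF that(1)] that(2)
        q01[OF k] q01[of "k + 1"]
      by (simp add: bound_def straddle_def c_def)
    then have "(\<Sum>x\<in>{x \<in> H. \<kappa> x = k}. tail_term n (pmf P x))
        \<le> real (card {x \<in> H. \<kappa> x = k}) * bound k"
      by (intro sum_bounded_above) auto
    also have "\<dots> \<le> real M * bound k"
      using cardM bound_nonneg[OF k] by (intro mult_right_mono)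
    finally show ?thesis .
  qed
  have "(\<Sum>x\<in>H. tail_term n (pmf P x)) =
      (\<Sum>k\<in>K. \<Sum>x\<in>{x \<in> H. \<kappa> x = k}. tail_term n (pmf P x))"
    unfolding K_def using fin(2) by (rule sum.image_gen)
  also have "\<dots> \<le> (\<Sum>k\<in>K. real M * bound k)"
    using inner by (rule sum_mono)
  also have "\<dots> = real M * (\<Sum>k\<in>K. bound k)"
    by (simp add: sum_distrib_left)
  also have "(\<Sum>k\<in>K. bound k) \<le> tail_index X Q n + tail_index X Q n + 1"
  proof -
    \<comment> \<open>The lower endpoints are again terms of \<open>q\<close> at distinct indices,
      so each family of endpoints costs one \<open>tail_index X Q n\<close>.\<close>
    have "(\<Sum>k\<in>K. tail_term n (q (k + 1))) = (\<Sum>k\<in>Suc ` K. tail_term n (q k))"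
      by (subst sum.reindex) auto
    also have "\<dots> \<le> tail_index X Q n"
      using fin(3) by (intro sum_ordered_version_le_tail_index[OF assms(2)]) auto
    finally have 1: "(\<Sum>k\<in>K. tail_term n (q (k + 1))) \<le> tail_index X Q n" .
    have 2: "(\<Sum>k\<in>K. tail_term n (q k)) \<le> tail_index X Q n"
      using fin(3) K1 by (rule sum_ordered_version_le_tail_index[OF assms(2)])
    have "(\<Sum>k\<in>K. straddle k) = real (card {k \<in> K. q (k + 1) < c \<and> c < q k})"
      using fin(3) by (simp add: straddle_def sum.If_cases Int_def)
    also have "\<dots> \<le> 1"
      using card_straddling_le_1[of q, OF mono fin(3) K1] by simp
    finally have 3: "(\<Sum>k\<in>K. straddle k) \<le> 1" .
    show ?thesis using 1 2 3 by (simp add: bound_def sum.distrib)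
  qed
  finally have sumH: "(\<Sum>x\<in>H. tail_term n (pmf P x))
      \<le> real M * (tail_index X Q n + tail_index X Q n + 1)"
    by (simp add: mult_left_mono)

  have "F = G \<union> H" "G \<inter> H = {}" by (auto simp: G_def H_def)
  then have "(\<Sum>x\<in>F. tail_term n (pmf P x)) =
      (\<Sum>x\<in>G. tail_term n (pmf P x)) + (\<Sum>x\<in>H. tail_term n (pmf P x))"
    using fin by (simp add: sum.union_disjoint)
  then show "(\<Sum>x\<in>F. tail_term n (pmf P x))
      \<le> 2 * real M * tail_index X Q n + real M + 1 / q 1"
    using sumG sumH by (simp add: algebra_simps)
qed

theorem theorem4:
  fixes X :: "'a set" and P Q :: "'a pmf"
  assumes "countable X" and "infinite X"
    and "P \<in> positive_dists X" and "Q \<in> positive_dists X"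
    and "Q \<in> Domain1 X"
    and "dominates X Q P"
  shows "P \<in> Domain1 X"
proof -
  obtain q M where q: "ordered_version X Q q"
    and bins: "\<And>k. k \<ge> 1 \<Longrightarrow> finite {x \<in> X. pmf P x \<in> {q (k + 1)<..q k}} \<and>
                card {x \<in> X. pmf P x \<in> {q (k + 1)<..q k}} \<le> M"
    using assms(6) unfolding dominates_def by blast
  obtain \<sigma> where \<sigma>: "bij_betw \<sigma> {1..} X" "\<And>k. k \<ge> 1 \<Longrightarrow> q k = pmf Q (\<sigma> k)"
    using q by (elim ordered_versionE) blast
  have "\<sigma> 1 \<in> X" using \<sigma>(1) by (auto simp: bij_betw_def)
  then have q1: "q 1 > 0"
    using \<sigma>(2)[of 1] assms(4) by (auto simp: positive_dists_def pmf_positive)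
  obtain c where "limsup (\<lambda>n. ereal (tail_index X Q n)) = ereal c"
    using assms(5) by (auto simp: Domain1_def)
  \<comment> \<open>The slack 1 makes the inequality strict, so that it passes to all large
    \<open>n\<close>.\<close>
  then have "limsup (\<lambda>n. ereal (tail_index X Q n)) < ereal (c + 1)" by simp
  then have "\<forall>\<^sub>F n in sequentially. ereal (tail_index X Q n) < ereal (c + 1)"
    by (rule Limsup_lessD)
  then have Qbound: "\<forall>\<^sub>F n in sequentially. tail_index X Q n < c + 1" by simp
  define B where "B = 2 * real M * (c + 1) + real M + 1 / q 1"
  have "\<forall>\<^sub>F n in sequentially. ereal (tail_index X P n) \<le> ereal B"
    using Qbound
  proof eventually_elim
    case (elim n)
    have "tail_index X P n \<le> 2 * real M * tail_index X Q n + real M + 1 / q 1"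
      by (rule tail_index_dominated_le[OF assms(3) q q1 bins])
    also have "\<dots> \<le> B"
      using elim unfolding B_def by (intro add_right_mono mult_left_mono) auto
    finally show ?case by simp
  qed
  then have upper: "limsup (\<lambda>n. ereal (tail_index X P n)) \<le> ereal B"
    by (rule Limsup_bounded)
  have lower: "ereal (1 / 8) \<le> limsup (\<lambda>n. ereal (tail_index X P n))"
  proof (rule ccontr)
    assume "\<not> ?thesis"
    then have "\<forall>\<^sub>F n in sequentially. ereal (tail_index X P n) < ereal (1 / 8)"
      by (intro Limsup_lessD) simp
    then have "\<forall>\<^sub>F n in sequentially. \<not> 1 / 8 \<le> tail_index X P n"
      by (simp add: not_le)
    then show False
      using tail_index_frequently_ge[OF assms(2,3)] by (simp add: frequently_def)
  qed
  \<comment> \<open>Real bounds on both sides exclude the two infinite values.\<close>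
  obtain d where d: "limsup (\<lambda>n. ereal (tail_index X P n)) = ereal d"
    using upper lower by (cases "limsup (\<lambda>n. ereal (tail_index X P n))") auto
  moreover have "d > 0" using lower d by simp
  ultimately show ?thesis using assms(3) by (auto simp: Domain1_def)
qed

end
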